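(* The first order differential operators $$\mathcal{D}=\partial_xx+x(A-1),\qquad \mathcal{D}^\dagger=-\partial_xx-(1+\nu+J)$$ are mutually adjoint with respect to $W^{(\nu)}$, i.e. $\langle P\cdot\mathcal{D},Q\rangle=\langle P,Q\cdot\mathcal{D}^\dagger\rangle$ for all $P,Q\in M_N(\mathbb{C})[x]$, and the monic matrix valued orthogonal polynomials $P(x,n)$ satisfy $P\cdot\mathcal{D}=M\cdot P$ and $P\cdot\mathcal{D}^\dagger=M^\dagger\cdot P$ with $$M=(A-1)\delta-(n+1+\nu)-\mathcal{H}(n)J\mathcal{H}(n)^{-1},$$ $$M^\dagger=-(n+\nu+J+1)+\mathcal{H}(n)(A-1)^*\mathcal{H}(n-1)^{-1}\delta^{-1}.$$
   Context: Let $N\ge1$, $\nu>0$, let $a_1,\dots,a_{N-1}$ be real, let $E_{i,j}$ be the matrix units, and put $J=\sum_{k=1}^NkE_{k,k}$, $A=\sum_{k=1}^{N-1}a_kE_{k+1,k}$. Let $\delta_1^{(\nu)},\dots,\delta_N^{(\nu)}>0$ and $$W^{(\nu)}(x)=e^{Ax}\,T^{(\nu)}(x)\,e^{A^*x},\qquad T^{(\nu)}(x)=e^{-x}\sum_{k=1}^N\delta_k^{(\nu)}x^{\nu+k}E_{k,k},\qquad x\in[0,\infty).$$ Put $\langle P,Q\rangle=\int_0^\infty P(x)W^{(\nu)}(x)Q(x)^*\,dx$, and let $(P(x,n))_{n\ge0}$ be the unique sequence of monic polynomials of degree $n$ in $M_N(\mathbb{C})[x]$ with $\langle P(x,n),P(x,m)\rangle=\delta_{n,m}\mathcal{H}(n)$.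 Differential operators act from the right: $P\cdot\sum_j\partial_x^jF_j(x)=\sum_jP^{(j)}(x)F_j(x)$. Difference operators act from the left: $(\sum_jA_j(n)\delta^j\cdot P)(x,n)=\sum_jA_j(n)P(x,n+j)$, with $P(x,m)=0$ for $m<0$ (so the $\delta^{-1}$ term is absent for $n=0$). Scalars denote multiples of the identity matrix. *)

theory Defs
  imports "HOL-Analysis.Analysis"
begin

type_synonym 'n cmat = "complex^'n^'n"

text \<open>
  The matrix size $N$ is \<open>CARD('n)\<close>. The class operation \<open>*\<close> on this type is componentwise;
  the matrix product is \<open>**\<close>, from which powers and the exponential are defined here.
\<close>

subsection \<open>Matrices\<close>

text \<open>
  The position in $\{1,\dots,N\}$ of an element of the index type. The matrix units, and
  everything built from them, are indexed by these positions.
\<close>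
definition pos :: "'n::{finite,linorder} \<Rightarrow> nat" where
  "pos i = card {j. j \<le> i}"

lemma bij_betw_pos: "bij_betw (pos :: 'n::{finite,linorder} \<Rightarrow> nat) UNIV {1..CARD('n)}"
proof -
  have less: "pos i < pos j" if "i < j" for i j :: 'n
    unfolding pos_def by (rule psubset_card_mono) (use that leD in \<open>auto simp: psubset_eq set_eq_iff\<close>)
  have "inj (pos :: 'n \<Rightarrow> nat)"
    by (rule linorder_injI) (use less in fastforce)
  moreover have "pos i \<in> {1..CARD('n)}" for i :: 'n
  proof -
    have "card {i} \<le> pos i"
      unfolding pos_def by (rule card_mono) auto
    moreover have "pos i \<le> CARD('n)"
      unfolding pos_def by (rule card_mono) auto
    ultimately show ?thesis by simp
  qed
  ultimately show ?thesis
    unfolding bij_betw_def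
    by (intro conjI card_subset_eq) (auto simp: card_image)
qed

definition munit :: "nat \<Rightarrow> nat \<Rightarrow> 'n::{finite,linorder} cmat" where
  "munit p q = (\<chi> i j. if pos i = p \<and> pos j = q then 1 else 0)"

definition madj :: "'n::finite cmat \<Rightarrow> 'n::finite cmat" where
  "madj X = (\<chi> i j. cnj (X $ j $ i))"

primrec mpow :: "'n::finite cmat \<Rightarrow> nat \<Rightarrow> 'n::finite cmat" where
  "mpow X 0 = mat 1"
| "mpow X (Suc k) = X ** mpow X k"

definition mexp :: "'n::finite cmat \<Rightarrow> 'n::finite cmat" where
  "mexp X = (\<Sum>k. (1 / fact k) *\<^sub>R mpow X k)"

definition J_mat :: "'n::{finite,linorder} cmat" where
  "J_mat = (\<Sum>k = 1..CARD('n). real k *\<^sub>R munit k k)"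

definition A_mat :: "(nat \<Rightarrow> real) \<Rightarrow> 'n::{finite,linorder} cmat" where
  "A_mat a = (\<Sum>k = 1..<CARD('n). a k *\<^sub>R munit (k + 1) k)"


subsection \<open>Weight, inner product and orthogonal polynomials\<close>

definition T_weight :: "real \<Rightarrow> (nat \<Rightarrow> real) \<Rightarrow> real \<Rightarrow> 'n::{finite,linorder} cmat" where
  "T_weight \<nu> d x =
     exp (- x) *\<^sub>R (\<Sum>k = 1..CARD('n). (d k * x powr (\<nu> + real k)) *\<^sub>R munit k k)"

definition weight ::
    "real \<Rightarrow> (nat \<Rightarrow> real) \<Rightarrow> (nat \<Rightarrow> real) \<Rightarrow> real \<Rightarrow> 'n::{finite,linorder} cmat" where
  "weight \<nu> a d x =
     mexp (x *\<^sub>R A_mat a) ** T_weight \<nu> d x ** mexp (x *\<^sub>R madj (A_mat a))"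

definition inner_prod ::
    "(real \<Rightarrow> 'n::finite cmat) \<Rightarrow> (real \<Rightarrow> 'n::finite cmat) \<Rightarrow> (real \<Rightarrow> 'n::finite cmat) \<Rightarrow> 'n::finite cmat"
  where "inner_prod W P Q = (LINT x:{0..}|lborel. P x ** W x ** madj (Q x))"

text \<open>
  Elements of $M_N(\mathbb{C})[x]$ are represented by the corresponding polynomial functions
  of a real variable.
\<close>
definition matpoly :: "(real \<Rightarrow> 'n::finite cmat) \<Rightarrow> bool" where
  "matpoly P \<longleftrightarrow> (\<exists>m c. \<forall>x. P x = (\<Sum>i\<le>m. x ^ i *\<^sub>R c i))"

definition monic_matpoly :: "nat \<Rightarrow> (real \<Rightarrow> 'n::finite cmat) \<Rightarrow> bool" where
  "monic_matpoly m P \<longleftrightarrow> (\<exists>c. c m = mat 1 \<and> (\<forall>x. P x = (\<Sum>i\<le>m. x ^ i *\<^sub>R c i)))"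

definition monic_mvop ::
    "(real \<Rightarrow> 'n::finite cmat) \<Rightarrow> (nat \<Rightarrow> real \<Rightarrow> 'n::finite cmat) \<Rightarrow> (nat \<Rightarrow> 'n::finite cmat) \<Rightarrow> bool" where
  "monic_mvop W P H \<longleftrightarrow>
     (\<forall>n. monic_matpoly n (P n)) \<and>
     (\<forall>n m. inner_prod W (P n) (P m) = (if n = m then H n else 0))"


subsection \<open>Differential and difference operators\<close>

text \<open>
  The list $[F_0, \dots, F_r]$ stands for the operator $\sum_j \partial_x^j F_j(x)$, which acts
  from the right.
\<close>
type_synonym 'n diffop = "(real \<Rightarrow> 'n cmat) list"

definition diffop_act ::
    "(real \<Rightarrow> 'n::finite cmat) \<Rightarrow> 'n diffop \<Rightarrow> real \<Rightarrow> 'n::finite cmat" (infixl "\<cdot>\<^sub>r" 70) where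
  "P \<cdot>\<^sub>r D =
     (\<lambda>x. \<Sum>j<length D. ((\<lambda>f y. vector_derivative f (at y)) ^^ j) P x ** (D ! j) x)"

text \<open>
  The list of pairs $(j, A_j)$ stands for the operator $\sum_j A_j(n) \delta^j$, which acts from
  the left on sequences extended by $0$ to negative indices.
\<close>
type_synonym 'n shiftop = "(int \<times> (nat \<Rightarrow> 'n cmat)) list"

definition ext0 :: "(nat \<Rightarrow> real \<Rightarrow> 'n::finite cmat) \<Rightarrow> int \<Rightarrow> real \<Rightarrow> 'n::finite cmat" where
  "ext0 P m = (if m < 0 then (\<lambda>x. 0) else P (nat m))"

definition shiftop_act ::
    "'n shiftop \<Rightarrow> (nat \<Rightarrow> real \<Rightarrow> 'n::finite cmat) \<Rightarrow> nat \<Rightarrow> real \<Rightarrow> 'n::finite cmat"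
    (infixr "\<cdot>\<^sub>l" 70) where
  "M \<cdot>\<^sub>l P = (\<lambda>n x. \<Sum>(j, B)\<leftarrow>M. B n ** ext0 P (int n + j) x)"

definition D_op :: "(nat \<Rightarrow> real) \<Rightarrow> 'n::{finite,linorder} diffop" where
  "D_op a = [\<lambda>x. x *\<^sub>R (A_mat a - mat 1), \<lambda>x. mat (of_real x)]"

definition D_dag :: "real \<Rightarrow> 'n::{finite,linorder} diffop" where
  "D_dag \<nu> = [\<lambda>x. - (mat (of_real (1 + \<nu>)) + J_mat), \<lambda>x. - mat (of_real x)]"

definition M_op ::
    "real \<Rightarrow> (nat \<Rightarrow> real) \<Rightarrow> (nat \<Rightarrow> 'n::{finite,linorder} cmat) \<Rightarrow> 'n::{finite,linorder} shiftop" where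
  "M_op \<nu> a H =
     [(1, \<lambda>n. A_mat a - mat 1),
      (0, \<lambda>n. - mat (of_real (real n + 1 + \<nu>)) - H n ** J_mat ** matrix_inv (H n))]"

text \<open>
  At $n = 0$ the truncated \<open>n - 1\<close> is harmless: the coefficient of $\delta^{-1}$ is then
  multiplied by the zero extension of the sequence.
\<close>
definition M_dag ::
    "real \<Rightarrow> (nat \<Rightarrow> real) \<Rightarrow> (nat \<Rightarrow> 'n::{finite,linorder} cmat) \<Rightarrow> 'n::{finite,linorder} shiftop" where
  "M_dag \<nu> a H =
     [(0, \<lambda>n. - (mat (of_real (real n + \<nu> + 1)) + J_mat)),
      (- 1, \<lambda>n. H n ** madj (A_mat a - mat 1) ** matrix_inv (H (n - 1)))]"

end

theory Submission
  imports Defs "HOL-Real_Asymp.Real_Asymp"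
begin

text \<open>
  Write $E(x) = e^{xA}$. Everything rests on a single first order equation for the weight,
  \[ x\,W'(x) = x(A-1)\,W(x) + W(x)\,(\nu + J). \]
  It holds because $xT' = T(\nu + J) - xT$, while $[A^*,J] = A^*$ gives
  $e^{xA^*} J = J e^{xA^*} + x A^* e^{xA^*}$, so that the term $x\,E T A^* E^*$ of $xW'$ turns the
  factor $J$ next to $T$ into a factor $J$ to the right of $W$ (\<open>weight_vector_derivative\<close>).
  
  By this equation the derivative of $x\,Q W R^*$ is
  $(Q \cdot \mathcal{D}) W R^* - Q W (R \cdot \mathcal{D}^\dagger)^*$. Integrating over
  $[0,\infty)$ gives the adjointness (\<open>weight_adjoint\<close>), because $x\,Q W R^*$ vanishes at both ends:
  $A$ is nilpotent, hence $E$ is a polynomial, and all integrands are finite sums of terms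
  $e^{-x} x^{s} C$ with $s > 0$ (\<open>weight_integrand_regularity\<close>).
  
  The recurrences follow from adjointness and degree counting alone, for any weight whose inner
  product is definite. $\mathcal{D}$ raises the degree by one, with
  $P_n \cdot \mathcal{D} = (A-1)\,x^{n+1} + \cdots$, and $\mathcal{D}^\dagger$ preserves it, with
  $P_n \cdot \mathcal{D}^\dagger = -(n+1+\nu+J)\,x^n + \cdots$. Expanding $P_n \cdot \mathcal{D}$ in the
  orthogonal polynomials, the coefficient of $P_j$ is
  $\langle P_n, P_j \cdot \mathcal{D}^\dagger\rangle \mathcal{H}(j)^{-1}$ for $j \le n$, which is zero
  for $j < n$ and is read off from the leading coefficient for $j = n$; the expansion of
  $P_n \cdot \mathcal{D}^\dagger$ is obtained in the same way
  (\<open>raising_recurrence\<close>, \<open>preserving_recurrence\<close>). Definiteness of the inner product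
  (\<open>weight_definite\<close>) makes every $\mathcal{H}(n)$ invertible, so that the coefficients can be solved
  for.
\<close>

section \<open>Matrix product and adjoint as linear operations\<close>

lemma bounded_bilinear_matrix_mult:
  "bounded_bilinear ((**) :: 'n::finite cmat \<Rightarrow> 'n cmat \<Rightarrow> 'n cmat)"
  unfolding bilinear_conv_bounded_bilinear[symmetric] bilinear_def
  by (auto intro!: linearI simp: matrix_matrix_mult_def vec_eq_iff sum.distrib algebra_simps
      scaleR_sum_right scaleR_conv_of_real[where 'a = complex] sum_distrib_left)

interpretation mm: bounded_bilinear "(**) :: 'n::finite cmat \<Rightarrow> 'n cmat \<Rightarrow> 'n cmat"
  by (rule bounded_bilinear_matrix_mult)

lemma bounded_linear_madj: "bounded_linear (madj :: 'n::finite cmat \<Rightarrow> 'n cmat)"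
  unfolding linear_conv_bounded_linear[symmetric]
  by (auto intro!: linearI simp: madj_def vec_eq_iff scaleR_conv_of_real[where 'a = complex])

lemmas linear_madj = bounded_linear.linear[OF bounded_linear_madj]
lemmas madj_add = linear_add[OF linear_madj]
  and madj_diff = linear_diff[OF linear_madj]
  and madj_minus = linear_neg[OF linear_madj]
  and madj_zero [simp] = linear_0[OF linear_madj]
  and madj_scaleR = linear_scale[OF linear_madj]
  and madj_sum = linear_sum[OF linear_madj]

lemma madj_madj [simp]: "madj (madj X) = X"
  by (simp add: madj_def vec_eq_iff)

lemma madj_mat [simp]: "madj (mat c) = mat (cnj c)"
  by (simp add: madj_def mat_def vec_eq_iff)

lemma madj_mult: "madj (X ** Y) = madj Y ** madj X"
  by (simp add: madj_def matrix_matrix_mult_def vec_eq_iff mult.commute)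

lemma mat_of_real_mult [simp]:
  "mat (of_real c) ** X = c *\<^sub>R X" "X ** mat (of_real c) = c *\<^sub>R (X :: 'n::finite cmat)"
  by (simp_all add: matrix_matrix_mult_def mat_def vec_eq_iff scaleR_conv_of_real[where 'a = complex] if_distrib[of "\<lambda>x. x * _"]
      if_distrib[of "\<lambda>x. _ * x"] mult.commute cong: if_cong)

section \<open>Matrix polynomials\<close>

text \<open>
  The strict bound makes \<open>deg_lt 0\<close> single out the zero polynomial, so that induction on the bound
  starts at zero, and ``equal up to terms of degree below $n$'' can be said for every $n$.
\<close>
definition deg_lt :: "nat \<Rightarrow> (real \<Rightarrow> 'n::finite cmat) \<Rightarrow> bool" where
  "deg_lt n P \<longleftrightarrow> (\<exists>c. \<forall>x. P x = (\<Sum>i<n. x ^ i *\<^sub>R c i))"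

lemma deg_ltI: "(\<And>x. P x = (\<Sum>i<n. x ^ i *\<^sub>R c i)) \<Longrightarrow> deg_lt n P"
  unfolding deg_lt_def by blast

lemma matpoly_iff_deg_lt: "matpoly P \<longleftrightarrow> (\<exists>n. deg_lt n P)"
proof
  assume "matpoly P"
  then show "\<exists>n. deg_lt n P"
    unfolding matpoly_def deg_lt_def lessThan_Suc_atMost[symmetric] by blast
next
  assume "\<exists>n. deg_lt n P"
  then obtain n c where c: "\<And>x. P x = (\<Sum>i<n. x ^ i *\<^sub>R c i)" unfolding deg_lt_def by blast
  have "P x = (\<Sum>i\<le>n. x ^ i *\<^sub>R (if i < n then c i else 0))" for x
    unfolding c by (rule sum.mono_neutral_cong_left) auto
  then show "matpoly P"
    unfolding matpoly_def by (intro exI[of _ n] exI[of _ "\<lambda>i. if i < n then c i else 0"] allI)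
qed

lemma deg_lt_imp_matpoly: "deg_lt n P \<Longrightarrow> matpoly P"
  using matpoly_iff_deg_lt by blast

lemma deg_lt_mono:
  assumes "deg_lt m P" "m \<le> n"
  shows "deg_lt n P"
proof -
  obtain c where c: "\<And>x. P x = (\<Sum>i<m. x ^ i *\<^sub>R c i)"
    using assms(1) unfolding deg_lt_def by blast
  show ?thesis
    by (rule deg_ltI[where c = "\<lambda>i. if i < m then c i else 0"], unfold c,
        rule sum.mono_neutral_cong_left) (use assms(2) in auto)
qed

lemma deg_lt_add: "deg_lt n P \<Longrightarrow> deg_lt n Q \<Longrightarrow> deg_lt n (\<lambda>x. P x + Q x)"
  unfolding deg_lt_def
proof (elim exE, goal_cases)
  case (1 c d)
  then show ?case by (intro exI[of _ "\<lambda>i. c i + d i"]) (simp add: sum.distrib scaleR_add_right)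
qed

lemma deg_lt_linear:
  assumes "linear f" "deg_lt n P"
  shows "deg_lt n (\<lambda>x. f (P x))"
proof -
  obtain c where c: "\<And>x. P x = (\<Sum>i<n. x ^ i *\<^sub>R c i)"
    using assms(2) unfolding deg_lt_def by blast
  show ?thesis
    by (rule deg_ltI[where c = "\<lambda>i. f (c i)"])
       (simp add: c linear_sum[OF assms(1)] linear_scale[OF assms(1)])
qed

lemma deg_lt_mult_left: "deg_lt n P \<Longrightarrow> deg_lt n (\<lambda>x. C ** P x)"
  by (rule deg_lt_linear) (rule bounded_linear.linear[OF mm.bounded_linear_right])

lemma deg_lt_mult_right: "deg_lt n P \<Longrightarrow> deg_lt n (\<lambda>x. P x ** C)"
  by (rule deg_lt_linear) (rule bounded_linear.linear[OF mm.bounded_linear_left])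

lemma deg_lt_uminus: "deg_lt n P \<Longrightarrow> deg_lt n (\<lambda>x. - P x)"
  by (rule deg_lt_linear) (rule linear_uminus)

lemma deg_lt_diff: "deg_lt n P \<Longrightarrow> deg_lt n Q \<Longrightarrow> deg_lt n (\<lambda>x. P x - Q x)"
  using deg_lt_add[OF _ deg_lt_uminus] by fastforce

lemma deg_lt_monom: "i < n \<Longrightarrow> deg_lt n (\<lambda>x. x ^ i *\<^sub>R C)"
  unfolding deg_lt_def
  by (rule exI[of _ "\<lambda>j. if j = i then C else 0"])
     (simp add: if_distrib[of "\<lambda>c. _ *\<^sub>R c"] cong: if_cong)

lemma deg_lt_times_x:
  assumes "deg_lt n P"
  shows "deg_lt (Suc n) (\<lambda>x. x *\<^sub>R P x)"
proof -
  obtain c where c: "\<And>x. P x = (\<Sum>i<n. x ^ i *\<^sub>R c i)"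
    using assms unfolding deg_lt_def by blast
  have "x *\<^sub>R P x = (\<Sum>i<Suc n. x ^ i *\<^sub>R (case i of 0 \<Rightarrow> 0 | Suc j \<Rightarrow> c j))" for x
    by (simp add: c sum.lessThan_Suc_shift scaleR_sum_right del: sum.lessThan_Suc)
  then show ?thesis unfolding deg_lt_def by blast
qed

lemma matpoly_const: "matpoly (\<lambda>x. C)"
  using deg_lt_imp_matpoly[OF deg_lt_monom[of 0 1 C]] by simp

lemma matpoly_add: "matpoly P \<Longrightarrow> matpoly Q \<Longrightarrow> matpoly (\<lambda>x. P x + Q x)"
  unfolding matpoly_iff_deg_lt
  by (elim exE) (rule exI, rule deg_lt_add[OF deg_lt_mono deg_lt_mono], assumption, rule max.cobounded1,
      assumption, rule max.cobounded2)

lemma matpoly_linear: "linear f \<Longrightarrow> matpoly P \<Longrightarrow> matpoly (\<lambda>x. f (P x))"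
  unfolding matpoly_iff_deg_lt using deg_lt_linear by blast

lemma matpoly_sum: "(\<And>i. i \<in> I \<Longrightarrow> matpoly (P i)) \<Longrightarrow> matpoly (\<lambda>x. \<Sum>i\<in>I. P i x)"
  by (induction I rule: infinite_finite_induct) (auto intro: matpoly_add matpoly_const)

lemma matpoly_pow_scaleR:
  assumes "matpoly P"
  shows "matpoly (\<lambda>x. x ^ k *\<^sub>R P x)"
proof (induction k)
  case (Suc k)
  then obtain n where "deg_lt n (\<lambda>x. x ^ k *\<^sub>R P x)" unfolding matpoly_iff_deg_lt by blast
  from deg_lt_imp_matpoly[OF deg_lt_times_x[OF this]] show ?case by simp
qed (use assms in simp)

lemma matpoly_mult:
  assumes "matpoly P" "matpoly Q"
  shows "matpoly (\<lambda>x. P x ** Q x)"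
proof -
  obtain n c where c: "\<And>x. P x = (\<Sum>i\<le>n. x ^ i *\<^sub>R c i)"
    using assms(1) unfolding matpoly_def by blast
  have "matpoly (\<lambda>x. \<Sum>i\<le>n. x ^ i *\<^sub>R (c i ** Q x))"
    by (intro matpoly_sum matpoly_pow_scaleR matpoly_linear[OF _ assms(2)]
        bounded_linear.linear[OF mm.bounded_linear_right])
  then show ?thesis by (simp add: c mm.sum_left mm.scaleR_left)
qed

lemma matpoly_madj: "matpoly P \<Longrightarrow> matpoly (\<lambda>x. madj (P x))"
  by (rule matpoly_linear[OF linear_madj])

text \<open>
  Each matrix entry is a scalar polynomial, which has finitely many complex roots unless all of its
  coefficients vanish.
\<close>
lemma matpoly_coefficients_eq_0:
  fixes c :: "nat \<Rightarrow> 'n::finite cmat"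
  assumes "infinite {x::real. (\<Sum>i\<le>n. x ^ i *\<^sub>R c i) = 0}" "k \<le> n"
  shows "c k = 0"
proof -
  have "c k $ i $ j = 0" for i j
  proof -
    have "complex_of_real ` {x. (\<Sum>k\<le>n. x ^ k *\<^sub>R c k) = 0} \<subseteq> {z. (\<Sum>k\<le>n. c k $ i $ j * z ^ k) = 0}"
    proof safe
      fix x :: real assume "(\<Sum>k\<le>n. x ^ k *\<^sub>R c k) = 0"
      then have "(\<Sum>k\<le>n. x ^ k *\<^sub>R c k) $ i $ j = 0" by simp
      then show "(\<Sum>k\<le>n. c k $ i $ j * complex_of_real x ^ k) = 0"
        by (simp add: scaleR_conv_of_real[where 'a = complex] mult.commute)
    qed
    then have "\<not> finite {z. (\<Sum>k\<le>n. c k $ i $ j * z ^ k) = 0}"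
      using assms(1) infinite_super by (fastforce simp: finite_image_iff inj_on_def)
    then show ?thesis using assms(2) unfolding polyfun_finite_roots by blast
  qed
  then show ?thesis by (simp add: vec_eq_iff)
qed

text \<open>
  The Euler operator $x\,\partial_x$ multiplies the coefficient of $x^i$ by $i$, so it does not raise
  the degree. The derivative occurs in both operators in this combination only.
\<close>
lemma deg_lt_derivative:
  assumes "deg_lt n P"
  shows "deg_lt n (\<lambda>x. x *\<^sub>R vector_derivative P (at x))"
    and "P differentiable at x"
proof -
  obtain c where c: "\<And>x. P x = (\<Sum>i<n. x ^ i *\<^sub>R c i)"
    using assms unfolding deg_lt_def by blast
  have *: "(P has_vector_derivative (\<Sum>i<n. (real i * x ^ (i - 1)) *\<^sub>R c i)) (at x)" for x
    unfolding c[abs_def] by (auto intro!: derivative_eq_intros)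
  have "x *\<^sub>R vector_derivative P (at x) = (\<Sum>i<n. x ^ i *\<^sub>R (real i *\<^sub>R c i))" for x
    unfolding vector_derivative_at[OF *] scaleR_sum_right
  proof (rule sum.cong, goal_cases)
    case (2 i)
    then show ?case by (cases i) auto
  qed simp
  then show "deg_lt n (\<lambda>x. x *\<^sub>R vector_derivative P (at x))"
    by (rule deg_ltI[where c = "\<lambda>i. real i *\<^sub>R c i"])
  show "P differentiable at x" using * by (rule differentiableI_vector)
qed

section \<open>Orthogonal polynomials and mutually adjoint operators\<close>

text \<open>
  The properties of a weight that the theory of monic orthogonal polynomials needs: all moments
  exist, the inner product is Hermitian, and it is definite on polynomials.
\<close>
locale matrix_weight =
  fixes W :: "real \<Rightarrow> 'n::finite cmat"
  assumes integrable: "matpoly P \<Longrightarrow> matpoly Q \<Longrightarrow>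
      set_integrable lborel {0..} (\<lambda>x. P x ** W x ** madj (Q x))"
    and hermitian: "madj (W x) = W x"
    and definite: "matpoly P \<Longrightarrow> inner_prod W P P = 0 \<Longrightarrow> P x = 0"
begin

abbreviation ip ("\<langle>_, _\<rangle>") where "\<langle>P, Q\<rangle> \<equiv> inner_prod W P Q"

lemma ip_add_left:
  assumes "matpoly P" "matpoly Q" "matpoly R"
  shows "\<langle>\<lambda>x. P x + Q x, R\<rangle> = \<langle>P, R\<rangle> + \<langle>Q, R\<rangle>"
  using set_integral_add(2)[OF integrable[OF assms(1,3)] integrable[OF assms(2,3)]]
  by (simp add: inner_prod_def mm.add_left)

lemma ip_mult_left:
  assumes "matpoly P" "matpoly R"
  shows "\<langle>\<lambda>x. C ** P x, R\<rangle> = C ** \<langle>P, R\<rangle>"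
  using integral_bounded_linear[OF mm.bounded_linear_right integrable[OF assms, unfolded set_integrable_def]]
  by (simp add: inner_prod_def set_lebesgue_integral_def mm.scaleR_right matrix_mul_assoc)

lemma ip_madj:
  assumes "matpoly P" "matpoly Q"
  shows "madj \<langle>P, Q\<rangle> = \<langle>Q, P\<rangle>"
  using integral_bounded_linear[OF bounded_linear_madj integrable[OF assms, unfolded set_integrable_def], symmetric]
  by (simp add: inner_prod_def set_lebesgue_integral_def madj_scaleR madj_mult hermitian matrix_mul_assoc)

lemma ip_add_right:
  assumes "matpoly P" "matpoly Q" "matpoly R"
  shows "\<langle>R, \<lambda>x. P x + Q x\<rangle> = \<langle>R, P\<rangle> + \<langle>R, Q\<rangle>"
  using arg_cong[OF ip_add_left[OF assms], of madj] assms by (simp add: ip_madj madj_add matpoly_add)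

lemma ip_mult_right:
  assumes "matpoly P" "matpoly R"
  shows "\<langle>R, \<lambda>x. C ** P x\<rangle> = \<langle>R, P\<rangle> ** madj C"
proof -
  have "matpoly (\<lambda>x. C ** P x)" by (intro matpoly_mult matpoly_const assms)
  then have "\<langle>R, \<lambda>x. C ** P x\<rangle> = madj \<langle>\<lambda>x. C ** P x, R\<rangle>" by (simp add: ip_madj assms)
  then show ?thesis by (simp add: ip_mult_left assms madj_mult ip_madj)
qed

end

locale mvop = matrix_weight W for W :: "real \<Rightarrow> 'n::finite cmat" +
  fixes P :: "nat \<Rightarrow> real \<Rightarrow> 'n cmat" and H :: "nat \<Rightarrow> 'n cmat"
  assumes mvop: "monic_mvop W P H"
begin

lemma ip_P: "\<langle>P n, P m\<rangle> = (if n = m then H n else 0)"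
  using mvop unfolding monic_mvop_def by blast

lemma deg_lt_P_minus_monom: "deg_lt n (\<lambda>x. P n x - x ^ n *\<^sub>R mat 1)"
proof -
  obtain c where "c n = mat 1" "\<And>x. P n x = (\<Sum>i\<le>n. x ^ i *\<^sub>R c i)"
    using mvop unfolding monic_mvop_def monic_matpoly_def by blast
  then show ?thesis
    by (intro deg_ltI[where c = c]) (simp add: lessThan_Suc_atMost[symmetric])
qed

lemma deg_lt_P: "deg_lt (Suc n) (P n)"
  using deg_lt_add[OF deg_lt_mono[OF deg_lt_P_minus_monom] deg_lt_monom[of n "Suc n" "mat 1"], of n]
  by simp

lemma matpoly_P: "matpoly (P n)"
  by (rule deg_lt_imp_matpoly[OF deg_lt_P])

text \<open>
  Subtracting the leading coefficient times $P_n$ lowers the degree, because $P_n$ is monic. This one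
  step of the expansion in the $P_j$ replaces the expansion itself in the induction below.
\<close>
lemma deg_lt_Suc_reduce:
  assumes "deg_lt (Suc n) Q"
  obtains C where "deg_lt n (\<lambda>x. Q x - C ** P n x)"
proof -
  obtain c where c: "\<And>x. Q x = (\<Sum>i<Suc n. x ^ i *\<^sub>R c i)"
    using assms unfolding deg_lt_def by blast
  have "deg_lt n (\<lambda>x. (\<Sum>i<n. x ^ i *\<^sub>R c i) - c n ** (P n x - x ^ n *\<^sub>R mat 1))"
    by (intro deg_lt_diff deg_lt_mult_left deg_lt_P_minus_monom) (rule deg_ltI[OF refl])
  then have "deg_lt n (\<lambda>x. Q x - c n ** P n x)"
    by (simp add: c mm.diff_right mm.scaleR_right algebra_simps)
  then show ?thesis by (rule that)
qed

lemma ip_reduce: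
  assumes "deg_lt k (\<lambda>x. Q x - C ** P n x)" "matpoly R"
  shows "\<langle>R, Q\<rangle> = \<langle>R, \<lambda>x. Q x - C ** P n x\<rangle> + \<langle>R, P n\<rangle> ** madj C"
proof -
  have "\<langle>R, \<lambda>x. (Q x - C ** P n x) + C ** P n x\<rangle> =
      \<langle>R, \<lambda>x. Q x - C ** P n x\<rangle> + \<langle>R, \<lambda>x. C ** P n x\<rangle>"
    by (intro ip_add_right deg_lt_imp_matpoly[OF assms(1)] assms matpoly_mult matpoly_const matpoly_P)
  then show ?thesis by (simp add: ip_mult_right matpoly_P assms)
qed

lemma ip_eq_0_if_orthogonal:
  assumes "deg_lt n Q" "matpoly R" "\<And>j. j < n \<Longrightarrow> \<langle>R, P j\<rangle> = 0"
  shows "\<langle>R, Q\<rangle> = 0"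
  using assms(1,3)
proof (induction n arbitrary: Q)
  case 0
  then have "Q = (\<lambda>x. 0)" by (auto simp: deg_lt_def)
  then show ?case by (simp add: inner_prod_def set_lebesgue_integral_def)
next
  case (Suc n)
  obtain C where "deg_lt n (\<lambda>x. Q x - C ** P n x)" by (rule deg_lt_Suc_reduce[OF Suc.prems(1)])
  then show ?case using Suc by (simp add: ip_reduce[OF _ assms(2)])
qed

text \<open>
  Such an $R$ is orthogonal to everything of its own degree, in particular to itself.
\<close>
lemma eq_0_if_orthogonal:
  assumes "deg_lt n R" "\<And>j. j < n \<Longrightarrow> \<langle>R, P j\<rangle> = 0"
  shows "R x = 0"
  using ip_eq_0_if_orthogonal[OF assms(1) _ assms(2)] assms(1) definite deg_lt_imp_matpoly by blast

text \<open>
  Only the top coefficient of $Q$ is seen by $P_n$, as the lower terms are orthogonal to it.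
\<close>
lemma ip_P_leading:
  assumes "deg_lt j (\<lambda>x. Q x - C ** P j x)" "j \<le> n"
  shows "\<langle>P n, Q\<rangle> = (if j = n then H n ** madj C else 0)"
proof -
  have "\<langle>P n, \<lambda>x. Q x - C ** P j x\<rangle> = 0"
    by (rule ip_eq_0_if_orthogonal[OF assms(1) matpoly_P]) (use assms(2) in \<open>auto simp: ip_P\<close>)
  then show ?thesis by (simp add: ip_reduce[OF assms(1) matpoly_P] ip_P)
qed

lemma leading_coefficient_eq_0:
  fixes C :: "'n cmat"
  assumes "\<And>x. C ** P n x = 0"
  shows "C = 0"
proof -
  obtain c where c: "c n = mat 1" "\<And>x. P n x = (\<Sum>i\<le>n. x ^ i *\<^sub>R c i)"
    using mvop unfolding monic_mvop_def monic_matpoly_def by blast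
  have "C ** P n x = (\<Sum>k\<le>n. x ^ k *\<^sub>R (C ** c k))" for x
    by (simp add: c(2) mm.sum_right mm.scaleR_right)
  then have "{x. (\<Sum>k\<le>n. x ^ k *\<^sub>R (C ** c k)) = 0} = UNIV" using assms by simp
  then have "C ** c n = 0"
    by (intro matpoly_coefficients_eq_0[where n = n and c = "\<lambda>k. C ** c k"]) (simp_all add: infinite_UNIV_char_0)
  then show ?thesis by (simp add: c(1))
qed

text \<open>
  If $\mathcal{H}(n) v = 0$, the constant matrix $C$ all of whose rows are $v^*$ satisfies
  $\langle C P_n, C P_n\rangle = C \mathcal{H}(n) C^* = 0$, which definiteness allows for $C = 0$ only.
\<close>
lemma invertible_H: "invertible (H n)"
proof -
  have "v = 0" if v: "H n *v v = 0" for v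
  proof -
    define C :: "'n cmat" where "C = (\<chi> i j. cnj (v $ j))"
    have "H n ** madj C = 0"
      using v by (simp add: C_def madj_def vec_eq_iff matrix_matrix_mult_def matrix_vector_mult_def)
    then have "\<langle>\<lambda>x. C ** P n x, \<lambda>x. C ** P n x\<rangle> = 0"
      using matpoly_mult[OF matpoly_const matpoly_P]
      by (simp add: ip_mult_left ip_mult_right matpoly_P ip_P)
    then have "C ** P n x = 0" for x
      using definite[OF matpoly_mult[OF matpoly_const matpoly_P]] by blast
    then have "C = 0" by (rule leading_coefficient_eq_0)
    then show "v = 0" by (simp add: C_def vec_eq_iff)
  qed
  then show ?thesis
    unfolding invertible_left_inverse matrix_left_invertible_injective vec.inj_iff_eq_0 by blast
qed

lemma H_matrix_inv: "H n ** matrix_inv (H n) = mat 1" "matrix_inv (H n) ** H n = mat 1"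
  using someI_ex[OF invertible_H[of n, unfolded invertible_def], folded matrix_inv_def] by auto

lemma matrix_inv_H: "X ** matrix_inv (H n) ** H n = X"
  by (simp add: matrix_mul_assoc[symmetric] H_matrix_inv)

text \<open>
  The form in which expansions are identified: a candidate $F$ agrees with $G$ as soon as the two
  agree up to degree below $k$ and have the same products with $P_0, \dots, P_{k-1}$.
\<close>
lemma eq_if_coefficients:
  assumes G: "deg_lt k (\<lambda>x. G x - F x)" and F: "matpoly F"
    and ip: "\<And>j. j < k \<Longrightarrow> \<langle>G, P j\<rangle> = \<langle>F, P j\<rangle>"
  shows "G x = F x"
proof -
  have "\<langle>\<lambda>x. (G x - F x) + F x, P j\<rangle> = \<langle>\<lambda>x. G x - F x, P j\<rangle> + \<langle>F, P j\<rangle>" for j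
    by (intro ip_add_left deg_lt_imp_matpoly[OF G] F matpoly_P)
  then have "\<langle>\<lambda>x. G x - F x, P j\<rangle> = 0" if "j < k" for j
    using ip[OF that] by simp
  from eq_0_if_orthogonal[OF G this] have "G x - F x = 0" .
  then show ?thesis by simp
qed

text \<open>
  A pair of mutually adjoint operators, of which $L$ raises the degree by one with leading
  coefficients \<open>B\<close>, and $L'$ preserves the degree with leading coefficients \<open>K\<close>.
\<close>
context
  fixes L L' :: "(real \<Rightarrow> 'n cmat) \<Rightarrow> real \<Rightarrow> 'n cmat" and B K :: "nat \<Rightarrow> 'n cmat"
  assumes raising: "\<And>n. deg_lt (Suc n) (\<lambda>x. L (P n) x - B n ** P (Suc n) x)"
    and preserving: "\<And>n. deg_lt n (\<lambda>x. L' (P n) x - K n ** P n x)"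
    and adjoint: "\<And>Q R. matpoly Q \<Longrightarrow> matpoly R \<Longrightarrow> \<langle>L Q, R\<rangle> = \<langle>Q, L' R\<rangle>"
begin

text \<open>
  For $j \le n$ the product $\langle L P_n, P_j\rangle = \langle P_n, L' P_j\rangle$ sees only the leading
  coefficient of $L' P_j$; it is $\mathcal{H}(n) K_n^*$ for $j = n$ and zero for $j < n$.
\<close>
lemma raising_recurrence:
  "L (P n) x = B n ** P (Suc n) x + (H n ** madj (K n) ** matrix_inv (H n)) ** P n x"
proof (rule eq_if_coefficients[where k = "Suc n"])
  let ?C = "H n ** madj (K n) ** matrix_inv (H n)"
  have *: "matpoly (\<lambda>x. X ** P m x)" for X m by (intro matpoly_mult matpoly_const matpoly_P)
  show "matpoly (\<lambda>x. B n ** P (Suc n) x + ?C ** P n x)" by (intro matpoly_add *)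
  show "deg_lt (Suc n) (\<lambda>x. L (P n) x - (B n ** P (Suc n) x + ?C ** P n x))"
    using deg_lt_diff[OF raising deg_lt_mult_left[OF deg_lt_P], of n ?C] by (simp add: diff_diff_eq)
  fix j assume "j < Suc n"
  then show "\<langle>L (P n), P j\<rangle> = \<langle>\<lambda>x. B n ** P (Suc n) x + ?C ** P n x, P j\<rangle>"
    by (simp add: adjoint matpoly_P ip_P_leading[OF preserving] ip_add_left[OF * * matpoly_P]
        ip_mult_left ip_P matrix_inv_H)
qed

text \<open>
  For $j < n$ the product $\langle L' P_n, P_j\rangle = \langle P_n, L P_j\rangle$ is nonzero only if
  $L P_j$ reaches degree $n$, that is for $j = n - 1$, where it is $\mathcal{H}(n) B_{n-1}^*$.
\<close>
lemma preserving_recurrence: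
  "L' (P n) x = K n ** P n x +
     (if n = 0 then 0 else (H n ** madj (B (n - 1)) ** matrix_inv (H (n - 1))) ** P (n - 1) x)"
proof -
  let ?C = "if n = 0 then 0 else H n ** madj (B (n - 1)) ** matrix_inv (H (n - 1))"
  have *: "matpoly (\<lambda>x. X ** P m x)" for X m by (intro matpoly_mult matpoly_const matpoly_P)
  have "L' (P n) x = K n ** P n x + ?C ** P (n - 1) x"
  proof (rule eq_if_coefficients[where k = n])
    show "matpoly (\<lambda>x. K n ** P n x + ?C ** P (n - 1) x)" by (intro matpoly_add *)
    have "deg_lt n (\<lambda>x. ?C ** P (n - 1) x)"
      using deg_lt_mult_left[OF deg_lt_P, of "n - 1" ?C] by (cases n) (auto simp: deg_lt_def)
    from deg_lt_diff[OF preserving this]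
    show "deg_lt n (\<lambda>x. L' (P n) x - (K n ** P n x + ?C ** P (n - 1) x))"
      by (simp add: diff_diff_eq)
    fix j assume j: "j < n"
    have mL: "matpoly (L' (P n))"
      using matpoly_add[OF deg_lt_imp_matpoly[OF preserving] *, of n "K n" n] by simp
    have mP: "matpoly (L (P j))"
      using matpoly_add[OF deg_lt_imp_matpoly[OF raising] *, of j "B j" "Suc j"] by simp
    have "\<langle>L' (P n), P j\<rangle> = madj \<langle>L (P j), P n\<rangle>"
      by (simp add: adjoint matpoly_P ip_madj mL)
    also have "\<dots> = \<langle>P n, L (P j)\<rangle>"
      by (simp add: ip_madj matpoly_P mP)
    also have "\<dots> = (if Suc j = n then H n ** madj (B j) else 0)"
      using j by (intro ip_P_leading raising) auto
    finally show "\<langle>L' (P n), P j\<rangle> = \<langle>\<lambda>x. K n ** P n x + ?C ** P (n - 1) x, P j\<rangle>"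
      using j by (auto simp: ip_add_left[OF * * matpoly_P] ip_mult_left matpoly_P ip_P matrix_inv_H)
  qed
  then show ?thesis by simp
qed

end

end

section \<open>Exponentials of nilpotent matrices\<close>

lemma mpow_scaleR: "mpow (x *\<^sub>R X) k = x ^ k *\<^sub>R mpow X k"
  by (induction k) (simp_all add: mm.scaleR_left mm.scaleR_right)

lemma mpow_commute: "X ** mpow X k = mpow X k ** X"
  by (induction k) (simp_all, metis matrix_mul_assoc)

lemma mpow_madj: "mpow (madj X) k = madj (mpow X k)"
  by (induction k) (simp_all add: madj_mult, metis madj_mult mpow_commute)

lemma mpow_eq_0: "mpow X m = 0 \<Longrightarrow> m \<le> k \<Longrightarrow> mpow X k = 0"
  by (induction k) (auto simp: le_Suc_eq)

lemma mexp_nilpotent: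
  assumes "mpow X m = 0"
  shows "mexp (x *\<^sub>R X) = (\<Sum>k<m. (x ^ k / fact k) *\<^sub>R mpow X k)"
  unfolding mexp_def mpow_scaleR
  by (subst suminf_finite[of "{..<m}"]) (auto simp: mpow_eq_0[OF assms] divide_inverse mult.commute)

lemma mexp_0 [simp]: "mexp (0 :: 'n::finite cmat) = mat 1"
  using mexp_nilpotent[of "0 :: 'n cmat" 1 0] by simp

lemma matpoly_mexp_nilpotent:
  assumes "mpow X m = 0"
  shows "matpoly (\<lambda>x. mexp (x *\<^sub>R X))"
  by (rule deg_lt_imp_matpoly[of m], rule deg_ltI[where c = "\<lambda>k. (1 / fact k) *\<^sub>R mpow X k"])
     (simp add: mexp_nilpotent[OF assms])

text \<open>
  The termwise derivative of the exponential sum. It is stated for the sum itself since the same sum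
  appears again, without any differentiation, in the commutator of $e^{xX}$ with $J$. Shifting the
  index by one leaves out the term of $X e^{xX}$ that contains $X^m$, which is zero.
\<close>
lemma sum_mexp_derivative:
  assumes "mpow X m = 0"
  shows "(\<Sum>k<m. (real k * x ^ (k - 1) / fact k) *\<^sub>R mpow X k) = X ** mexp (x *\<^sub>R X)"
proof (cases m)
  case (Suc l)
  have "(\<Sum>k<m. (real k * x ^ (k - 1) / fact k) *\<^sub>R mpow X k) =
      (\<Sum>k<l. (x ^ k / fact k) *\<^sub>R mpow X (Suc k))"
    unfolding Suc sum.lessThan_Suc_shift
    by (simp add: fact_Suc del: mpow.simps(2) of_nat_Suc)
  also have "\<dots> = (\<Sum>k<m. (x ^ k / fact k) *\<^sub>R mpow X (Suc k))"
    using assms by (simp add: Suc)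
  also have "\<dots> = X ** mexp (x *\<^sub>R X)"
    by (simp add: mexp_nilpotent[OF assms] mm.sum_right mm.scaleR_right)
  finally show ?thesis .
next
  case 0
  then have "X ** Y = 0" for Y using assms matrix_mul_lid[of "X ** Y"] by simp
  then show ?thesis using 0 by simp
qed

lemma mexp_has_vector_derivative:
  assumes "mpow X m = 0"
  shows "((\<lambda>x. mexp (x *\<^sub>R X)) has_vector_derivative X ** mexp (x *\<^sub>R X)) (at x)"
proof -
  have "((\<lambda>x. \<Sum>k<m. (x ^ k / fact k) *\<^sub>R mpow X k) has_vector_derivative
      (\<Sum>k<m. (real k * x ^ (k - 1) / fact k) *\<^sub>R mpow X k)) (at x)"
    by (auto intro!: derivative_eq_intros)
  then show ?thesis
    by (simp only: mexp_nilpotent[OF assms, symmetric] sum_mexp_derivative[OF assms])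
qed

text \<open>
  The product has derivative $X e^{xX} e^{-xX} - e^{xX} X e^{-xX} = 0$ and equals $1$ at $x = 0$.
\<close>
lemma mexp_minus_inverse:
  assumes "mpow X m = 0"
  shows "mexp (x *\<^sub>R X) ** mexp (- x *\<^sub>R X) = mat 1"
proof -
  have comm: "mexp (y *\<^sub>R X) ** X = X ** mexp (y *\<^sub>R X)" for y
    by (simp add: mexp_nilpotent[OF assms] mm.sum_right mm.sum_left mm.scaleR_right mm.scaleR_left mpow_commute)
  have "mpow (- X) m = 0" using mpow_scaleR[of "- 1" X m] assms by simp
  from mexp_has_vector_derivative[OF this]
  have neg: "((\<lambda>y. mexp (- y *\<^sub>R X)) has_vector_derivative - (X ** mexp (- y *\<^sub>R X))) (at y)" for y
    by (simp add: mm.minus_left)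
  have "((\<lambda>y. mexp (y *\<^sub>R X) ** mexp (- y *\<^sub>R X)) has_vector_derivative 0) (at y)" for y
    using mm.has_vector_derivative[OF mexp_has_vector_derivative[OF assms] neg, of y]
    by (simp add: mm.minus_right matrix_mul_assoc comm)
  then have "(\<lambda>y. mexp (y *\<^sub>R X) ** mexp (- y *\<^sub>R X)) x = mexp (0 *\<^sub>R X) ** mexp (- 0 *\<^sub>R X)"
    by (intro has_derivative_zero_unique[of UNIV _ _ 0, simplified]) (auto simp: has_vector_derivative_def)
  then show ?thesis by simp
qed

text \<open>
  The hypothesis says that $X$ is an eigenvector of $\mathrm{ad}_J$; the derivation $\mathrm{ad}_J$ then
  multiplies $X^k$ by $k$ times that eigenvalue.
\<close>
lemma mpow_commutator:
  assumes "X ** J = J ** X + X"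
  shows "mpow X k ** J = J ** mpow X k + real k *\<^sub>R mpow X k"
proof (induction k)
  case (Suc k)
  have "mpow X (Suc k) ** J = X ** (mpow X k ** J)" by (simp add: matrix_mul_assoc)
  also have "\<dots> = (X ** J) ** mpow X k + real k *\<^sub>R (X ** mpow X k)"
    unfolding Suc by (simp add: mm.add_right mm.scaleR_right matrix_mul_assoc)
  also have "\<dots> = J ** mpow X (Suc k) + real (Suc k) *\<^sub>R mpow X (Suc k)"
    unfolding assms by (simp add: mm.add_left matrix_mul_assoc algebra_simps)
  finally show ?case .
qed simp

text \<open>
  As $X^k$ picks up the factor $k$, the commutator of $e^{xX}$ with $J$ is $x\,\partial_x e^{xX}$.
\<close>
lemma mexp_commutator:
  assumes "X ** J = J ** X + X" "mpow X m = 0"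
  shows "mexp (x *\<^sub>R X) ** J = J ** mexp (x *\<^sub>R X) + x *\<^sub>R (X ** mexp (x *\<^sub>R X))"
proof -
  have "(x ^ k / fact k) *\<^sub>R (real k *\<^sub>R mpow X k) =
      x *\<^sub>R ((real k * x ^ (k - 1) / fact k) *\<^sub>R mpow X k)" for k
    by (cases k) (simp_all add: mult_ac del: mpow.simps)
  then have "(\<Sum>k<m. (x ^ k / fact k) *\<^sub>R (real k *\<^sub>R mpow X k)) = x *\<^sub>R (X ** mexp (x *\<^sub>R X))"
    unfolding sum_mexp_derivative[OF assms(2), symmetric] scaleR_sum_right by (intro sum.cong refl)
  moreover have "mexp (x *\<^sub>R X) ** J = J ** mexp (x *\<^sub>R X) + (\<Sum>k<m. (x ^ k / fact k) *\<^sub>R (real k *\<^sub>R mpow X k))"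
    by (simp only: mexp_nilpotent[OF assms(2)] mm.sum_left mm.sum_right mm.scaleR_left mm.scaleR_right
        mpow_commutator[OF assms(1)] scaleR_add_right sum.distrib)
  ultimately show ?thesis by simp
qed

lemma mexp_madj:
  assumes "mpow X m = 0"
  shows "mexp (x *\<^sub>R madj X) = madj (mexp (x *\<^sub>R X))"
  using assms by (simp add: mexp_nilpotent[of _ m] mpow_madj madj_sum madj_scaleR)


section \<open>The matrices $A$ and $J$\<close>
lemma pos_bounds: "1 \<le> pos (i :: 'n::{finite,linorder})" "pos (i :: 'n) \<le> CARD('n)"
  using bij_betwE[OF bij_betw_pos[where 'n = 'n]] by auto

lemma pos_eq_iff [simp]: "pos i = pos j \<longleftrightarrow> i = (j :: 'n::{finite,linorder})"
  using bij_betw_imp_inj_on[OF bij_betw_pos[where 'n = 'n]] by (auto dest: injD)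

lemma sum_munit_diag:
  "(\<Sum>k = 1..CARD('n). f k *\<^sub>R munit k k :: 'n::{finite,linorder} cmat) =
    (\<chi> i j. if i = j then complex_of_real (f (pos i)) else (0 :: complex))"
  for f :: "nat \<Rightarrow> real"
proof -
  have "(\<Sum>k = 1..CARD('n). f k *\<^sub>R munit k k :: 'n cmat) $ i $ j =
      (if i = j then complex_of_real (f (pos i)) else 0)" for i j
  proof -
    have "(\<Sum>k = 1..CARD('n). f k *\<^sub>R munit k k :: 'n cmat) $ i $ j =
        (\<Sum>k = 1..CARD('n). if k = pos i then (if i = j then complex_of_real (f (pos i)) else 0) else 0)"
      unfolding sum_component
      by (intro sum.cong refl) (auto simp: munit_def scaleR_conv_of_real[where 'a = complex])
    also have "\<dots> = (if i = j then complex_of_real (f (pos i)) else 0)"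
      using pos_bounds[of i] by simp
    finally show ?thesis .
  qed
  then show ?thesis by (simp add: vec_eq_iff)
qed

lemma J_mat_nth: "(J_mat :: 'n::{finite,linorder} cmat) $ i $ j = (if i = j then of_nat (pos i) else 0)"
  unfolding J_mat_def sum_munit_diag by simp

lemma madj_J_mat: "madj (J_mat :: 'n::{finite,linorder} cmat) = J_mat"
  by (simp add: madj_def vec_eq_iff J_mat_nth)

lemma J_mult_nth:
  "(J_mat ** X) $ i $ j = of_nat (pos i) * X $ i $ j"
  "(X ** J_mat) $ i $ j = of_nat (pos j) * (X :: 'n::{finite,linorder} cmat) $ i $ j"
  by (simp_all add: matrix_matrix_mult_def J_mat_nth if_distrib[of "\<lambda>x. x * _"]
      if_distrib[of "\<lambda>x. _ * x"] mult.commute cong: if_cong)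

lemma A_mat_nth:
  "(A_mat a :: 'n::{finite,linorder} cmat) $ i $ j = (if pos i = pos j + 1 then of_real (a (pos j)) else 0)"
proof -
  have "(A_mat a :: 'n cmat) $ i $ j = (\<Sum>k = 1..<CARD('n). if k = pos j then
      (if pos i = pos j + 1 then of_real (a (pos j)) else 0) else 0)"
    unfolding A_mat_def sum_component
    by (intro sum.cong refl) (auto simp: munit_def scaleR_conv_of_real[where 'a = complex])
  also have "\<dots> = (if pos i = pos j + 1 then of_real (a (pos j)) else 0)"
    using pos_bounds[of i] pos_bounds[of j] by simp
  finally show ?thesis .
qed

lemma madj_A_J_commutator:
  "madj (A_mat a) ** J_mat = J_mat ** madj (A_mat a) + (madj (A_mat a) :: 'n::{finite,linorder} cmat)"
  by (simp add: vec_eq_iff J_mult_nth madj_def A_mat_nth algebra_simps)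

text \<open>
  Let $Y = (A^*)^N$. By \<open>mpow_commutator\<close> the entries satisfy
  $(\mathrm{pos}\,j - \mathrm{pos}\,i - N)\,Y_{ij} = 0$, and two positions in $\{1,\dots,N\}$ never differ
  by $N$.
\<close>
lemma mpow_madj_A_eq_0: "mpow (madj (A_mat a) :: 'n::{finite,linorder} cmat) CARD('n) = 0"
proof -
  have "mpow (madj (A_mat a) :: 'n cmat) CARD('n) $ i $ j = 0" for i j
  proof -
    let ?X = "mpow (madj (A_mat a) :: 'n cmat) CARD('n) $ i $ j"
    have "of_nat (pos j) * ?X = of_nat (pos i) * ?X + of_nat CARD('n) * ?X"
      using arg_cong[OF mpow_commutator[OF madj_A_J_commutator[where 'n = 'n], of a "CARD('n)"], of "\<lambda>X. X $ i $ j"]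
      by (simp add: J_mult_nth scaleR_conv_of_real[where 'a = complex])
    then have "of_nat (pos j) * ?X = of_nat (pos i + CARD('n)) * ?X"
      by (simp add: algebra_simps)
    moreover have "pos j \<noteq> pos i + CARD('n)" using pos_bounds[of i] pos_bounds[of j] by linarith
    ultimately show ?thesis by (metis mult_cancel_right of_nat_eq_iff)
  qed
  then show ?thesis by (simp add: vec_eq_iff)
qed

lemma mpow_A_eq_0: "mpow (A_mat a :: 'n::{finite,linorder} cmat) CARD('n) = 0"
  using mpow_madj_A_eq_0[of a, where 'n = 'n] by (metis madj_madj madj_zero mpow_madj)

section \<open>The weight\<close>

lemma T_weight_nth:
  "(T_weight \<nu> d x :: 'n::{finite,linorder} cmat) $ i $ j =
    (if i = j then of_real (exp (- x) * (d (pos i) * x powr (\<nu> + real (pos i)))) else 0)"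
  unfolding T_weight_def sum_munit_diag by (simp add: scaleR_conv_of_real[where 'a = complex])

lemma munit_mult_J: "munit k k ** J_mat = real k *\<^sub>R (munit k k :: 'n::{finite,linorder} cmat)"
  by (auto simp: vec_eq_iff J_mult_nth munit_def scaleR_conv_of_real[where 'a = complex])

text \<open>
  The diagonal entries are multiples of $e^{-x} x^{\nu+k}$, whose Euler derivative is
  $(\nu + k - x)\,e^{-x} x^{\nu+k}$; the factors $k$ assemble to $J$.
\<close>
lemma T_weight_vector_derivative:
  assumes "x > 0"
  obtains T' :: "'n::{finite,linorder} cmat" where
    "(T_weight \<nu> d has_vector_derivative T') (at x)"
    "x *\<^sub>R T' = \<nu> *\<^sub>R T_weight \<nu> d x + T_weight \<nu> d x ** J_mat - x *\<^sub>R T_weight \<nu> d x"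
proof
  let ?t = "\<lambda>k. d k * (exp (- x) * ((\<nu> + real k) * x powr (\<nu> + real k - 1) - x powr (\<nu> + real k)))"
  have "((\<lambda>x. exp (- x) * (d k * x powr (\<nu> + real k))) has_real_derivative ?t k) (at x)" for k
    using assms by (auto intro!: derivative_eq_intros simp: algebra_simps)
  then have "((\<lambda>x. \<Sum>k = 1..CARD('n). (exp (- x) * (d k * x powr (\<nu> + real k))) *\<^sub>R munit k k) has_vector_derivative
      (\<Sum>k = 1..CARD('n). ?t k *\<^sub>R munit k k :: 'n cmat)) (at x)"
    by (intro has_vector_derivative_sum bounded_linear.has_vector_derivative[OF bounded_linear_scaleR_left])
       (simp add: has_real_derivative_iff_has_vector_derivative)
  then show "(T_weight \<nu> d has_vector_derivative (\<Sum>k = 1..CARD('n). ?t k *\<^sub>R munit k k :: 'n cmat)) (at x)"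
    by (simp add: T_weight_def[abs_def] scaleR_sum_right)
  have pw: "x * x powr (\<nu> + real k - 1) = x powr (\<nu> + real k)" for k
    using assms by (simp add: powr_diff)
  have "x * ?t k = \<nu> * (exp (- x) * (d k * x powr (\<nu> + real k))) +
      real k * (exp (- x) * (d k * x powr (\<nu> + real k))) - x * (exp (- x) * (d k * x powr (\<nu> + real k)))" for k
    by (simp add: algebra_simps pw[symmetric])
  then show "x *\<^sub>R (\<Sum>k = 1..CARD('n). ?t k *\<^sub>R munit k k :: 'n cmat) =
      \<nu> *\<^sub>R T_weight \<nu> d x + T_weight \<nu> d x ** J_mat - x *\<^sub>R T_weight \<nu> d x"
    by (simp add: T_weight_def scaleR_sum_right mm.sum_left mm.scaleR_left munit_mult_J
        sum.distrib[symmetric] sum_subtractf[symmetric] scaleR_add_left[symmetric] scaleR_diff_left[symmetric]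
        mult.commute mult.left_commute)
qed

lemma weight_eq:
  "weight \<nu> a d x = mexp (x *\<^sub>R A_mat a) ** T_weight \<nu> d x ** madj (mexp (x *\<^sub>R A_mat a))"
  by (simp add: weight_def mexp_madj[OF mpow_A_eq_0])

lemma weight_0 [simp]: "weight \<nu> a d 0 = 0"
  by (simp add: weight_def T_weight_def)
lemma madj_weight: "madj (weight \<nu> a d x) = (weight \<nu> a d x :: 'n::{finite,linorder} cmat)"
proof -
  have "madj (T_weight \<nu> d x :: 'n cmat) = T_weight \<nu> d x"
    by (simp add: vec_eq_iff madj_def T_weight_nth)
  then show ?thesis by (simp add: weight_eq madj_mult matrix_mul_assoc)
qed

text \<open>
  The matrix analogue of Pearson's equation for the Laguerre weight, and the source of the pair of
  operators.
\<close>
lemma weight_vector_derivative: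
  fixes \<nu> x :: real and a d :: "nat \<Rightarrow> real"
  assumes "x > 0"
  obtains W' :: "'n::{finite,linorder} cmat" where
    "(weight \<nu> a d has_vector_derivative W') (at x)"
    "x *\<^sub>R W' = x *\<^sub>R ((A_mat a - mat 1) ** weight \<nu> a d x) + \<nu> *\<^sub>R weight \<nu> a d x + weight \<nu> a d x ** J_mat"
proof -
  let ?A = "A_mat a :: 'n cmat" and ?T = "T_weight \<nu> d :: real \<Rightarrow> 'n cmat"
  let ?E = "\<lambda>x. mexp (x *\<^sub>R ?A)" and ?E' = "\<lambda>x. mexp (x *\<^sub>R madj ?A)"
  obtain T' where T': "(?T has_vector_derivative T') (at x)"
    "x *\<^sub>R T' = \<nu> *\<^sub>R ?T x + ?T x ** J_mat - x *\<^sub>R ?T x"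
    by (rule T_weight_vector_derivative[OF assms])
  show thesis
  proof
    show "(weight \<nu> a d has_vector_derivative
        ((?E x ** ?T x) ** (madj ?A ** ?E' x) + (?E x ** T' + (?A ** ?E x) ** ?T x) ** ?E' x)) (at x)"
      unfolding weight_def[abs_def]
      by (intro mm.has_vector_derivative mexp_has_vector_derivative[OF mpow_A_eq_0]
          mexp_has_vector_derivative[OF mpow_madj_A_eq_0] T')
    \<comment> \<open>The relation that moves \<open>J\<close> from the inside of the weight to its right.\<close>
    have J: "?E' x ** J_mat = J_mat ** ?E' x + x *\<^sub>R (madj ?A ** ?E' x)"
      by (rule mexp_commutator[OF madj_A_J_commutator mpow_madj_A_eq_0])
    have "x *\<^sub>R ((?E x ** ?T x) ** (madj ?A ** ?E' x) + (?E x ** T' + (?A ** ?E x) ** ?T x) ** ?E' x) =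
       (?E x ** ?T x) ** (x *\<^sub>R (madj ?A ** ?E' x)) + ?E x ** (x *\<^sub>R T') ** ?E' x + x *\<^sub>R (?A ** weight \<nu> a d x)"
      by (simp add: mm.add_left mm.scaleR_left mm.scaleR_right scaleR_add_right weight_def matrix_mul_assoc)
    also have "\<dots> = (?E x ** ?T x) ** (?E' x ** J_mat - J_mat ** ?E' x)
       + ?E x ** (\<nu> *\<^sub>R ?T x + ?T x ** J_mat - x *\<^sub>R ?T x) ** ?E' x + x *\<^sub>R (?A ** weight \<nu> a d x)"
      by (simp add: J T'(2))
    also have "\<dots> = x *\<^sub>R ((?A - mat 1) ** weight \<nu> a d x) + \<nu> *\<^sub>R weight \<nu> a d x + weight \<nu> a d x ** J_mat"
      by (simp add: mm.add_left mm.diff_left mm.add_right mm.diff_right mm.scaleR_left mm.scaleR_right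
          scaleR_diff_right weight_def matrix_mul_assoc)
    finally show "x *\<^sub>R ((?E x ** ?T x) ** (madj ?A ** ?E' x) + (?E x ** T' + (?A ** ?E x) ** ?T x) ** ?E' x) = \<dots>" .
  qed
qed

lemma powr_exp_integrable:
  assumes "s > 0"
  shows "set_integrable lborel {0..} (\<lambda>x::real. exp (- x) * x powr s)"
proof -
  have "((\<lambda>x. x powr s / exp x) has_integral Gamma (s + 1)) {0..}"
    using Gamma_integral_real[of "s + 1"] assms by simp
  then have "(\<lambda>x. x powr s / exp x) absolutely_integrable_on {0..}"
    by (intro nonnegative_absolutely_integrable_1) auto
  then have "set_integrable lebesgue {0..} (\<lambda>x. exp (- x) * x powr s)"
    by (simp add: exp_minus field_simps)
  then show ?thesis
    unfolding set_integrable_def by (subst (asm) integrable_completion) auto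
qed

lemma powr_exp_tendsto_at_top: "((\<lambda>x::real. exp (- x) * x powr s) \<longlongrightarrow> 0) at_top"
  by real_asymp

lemma powr_exp_tendsto_at_right_0:
  "s > 0 \<Longrightarrow> ((\<lambda>x::real. exp (- x) * x powr s) \<longlongrightarrow> 0) (at_right 0)"
  by real_asymp
text \<open>
  Expanding $G$ in powers of $x$ leaves finitely many terms $e^{-x} x^{s+i} C$, for which integrability
  is the existence of $\Gamma(s+i+1)$.
\<close>
lemma laguerre_times_matpoly:
  fixes G :: "real \<Rightarrow> 'n::finite cmat"
  assumes "s > 0" "matpoly G"
  shows "set_integrable lborel {0..} (\<lambda>x. (exp (- x) * x powr s) *\<^sub>R G x)"
    and "((\<lambda>x. (exp (- x) * x powr s) *\<^sub>R G x) \<longlongrightarrow> 0) at_top"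
    and "((\<lambda>x. (exp (- x) * x powr s) *\<^sub>R G x) \<longlongrightarrow> 0) (at_right 0)"
proof -
  obtain n c where c: "\<And>x. G x = (\<Sum>i\<le>n. x ^ i *\<^sub>R c i)"
    using assms(2) unfolding matpoly_def by blast
  have eq: "(exp (- x) * x powr s) *\<^sub>R G x = (\<Sum>i\<le>n. (exp (- x) * x powr (s + real i)) *\<^sub>R c i)"
    if "x \<ge> 0" for x
  \<comment> \<open>At the endpoint both sides vanish because \<open>0 powr s = 0\<close>.\<close>
  proof (cases "x = 0")
    case False
    then have "x powr (s + real i) = x powr s * x ^ i" for i
      using that by (simp add: powr_add powr_realpow)
    then show ?thesis by (simp add: c scaleR_sum_right mult_ac)
  next
    case True then show ?thesis using assms(1) by simp
  qed
  have "set_integrable lborel {0..} (\<lambda>x. \<Sum>i\<le>n. (exp (- x) * x powr (s + real i)) *\<^sub>R c i)"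
    using assms(1) unfolding set_integrable_def scaleR_sum_right
    by (intro Bochner_Integration.integrable_sum set_integrable_scaleR_left[unfolded set_integrable_def]
        powr_exp_integrable[unfolded set_integrable_def]) simp_all
  then show "set_integrable lborel {0..} (\<lambda>x. (exp (- x) * x powr s) *\<^sub>R G x)"
    by (rule set_integrable_cong[THEN iffD1, rotated -1]) (auto simp: eq)
  have *: "((\<lambda>x. \<Sum>i\<le>n. (exp (- x) * x powr (s + real i)) *\<^sub>R c i) \<longlongrightarrow> (\<Sum>i\<le>n. 0 *\<^sub>R c i)) F"
    if "\<And>t. t > 0 \<Longrightarrow> ((\<lambda>x. exp (- x) * x powr t) \<longlongrightarrow> 0) F" for F
    using assms(1) by (intro tendsto_intros that) simp
  show "((\<lambda>x. (exp (- x) * x powr s) *\<^sub>R G x) \<longlongrightarrow> 0) at_top"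
    by (rule Lim_transform_eventually[OF *[OF powr_exp_tendsto_at_top, simplified]])
       (auto intro!: eventually_mono[OF eventually_ge_at_top[of 0]] eq[symmetric])
  show "((\<lambda>x. (exp (- x) * x powr s) *\<^sub>R G x) \<longlongrightarrow> 0) (at_right 0)"
    by (rule Lim_transform_eventually[OF *[OF powr_exp_tendsto_at_right_0, simplified]])
       (auto intro!: eventually_mono[OF eventually_at_right_less[of 0]] eq[symmetric])
qed

text \<open>
  The entries of $T$ carry the only factors that are not polynomial in $x$; splitting $T$ into its
  diagonal matrix units isolates them.
\<close>
lemma weight_integrand_eq:
  fixes P Q :: "real \<Rightarrow> 'n::{finite,linorder} cmat"
  shows "P x ** weight \<nu> a d x ** madj (Q x) = (\<Sum>k = 1..CARD('n). (exp (- x) * x powr (\<nu> + real k)) *\<^sub>R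
    (P x ** mexp (x *\<^sub>R A_mat a) ** (d k *\<^sub>R munit k k) ** mexp (x *\<^sub>R madj (A_mat a)) ** madj (Q x)))"
  by (simp add: weight_def T_weight_def scaleR_sum_right mm.sum_left mm.sum_right
      mm.scaleR_left mm.scaleR_right matrix_mul_assoc mult_ac)

text \<open>
  The two limits serve as the boundary terms of the integration by parts. Here positivity of the
  exponents and nilpotency of $A$ enter.
\<close>
lemma weight_integrand_regularity:
  fixes P Q :: "real \<Rightarrow> 'n::{finite,linorder} cmat"
  assumes "\<nu> > 0" "matpoly P" "matpoly Q"
  shows "set_integrable lborel {0..} (\<lambda>x. P x ** weight \<nu> a d x ** madj (Q x))"
    and "((\<lambda>x. P x ** weight \<nu> a d x ** madj (Q x)) \<longlongrightarrow> 0) at_top"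
    and "((\<lambda>x. P x ** weight \<nu> a d x ** madj (Q x)) \<longlongrightarrow> 0) (at_right 0)"
proof -
  define G where "G k x = P x ** mexp (x *\<^sub>R A_mat a) ** (d k *\<^sub>R munit k k) ** mexp (x *\<^sub>R madj (A_mat a)) ** madj (Q x)" for k x
  have G: "matpoly (G k)" for k
    unfolding G_def by (intro matpoly_mult matpoly_const matpoly_madj assms
        matpoly_mexp_nilpotent[OF mpow_A_eq_0] matpoly_mexp_nilpotent[OF mpow_madj_A_eq_0])
  have s: "\<nu> + real k > 0" for k using assms(1) by simp
  have eq: "(\<lambda>x. P x ** weight \<nu> a d x ** madj (Q x)) =
      (\<lambda>x. \<Sum>k = 1..CARD('n). (exp (- x) * x powr (\<nu> + real k)) *\<^sub>R G k x)"
    by (simp add: weight_integrand_eq G_def)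
  note L = laguerre_times_matpoly[OF s G]
  show "set_integrable lborel {0..} (\<lambda>x. P x ** weight \<nu> a d x ** madj (Q x))"
    unfolding eq set_integrable_def scaleR_sum_right
    by (intro Bochner_Integration.integrable_sum L(1)[unfolded set_integrable_def])
  show "((\<lambda>x. P x ** weight \<nu> a d x ** madj (Q x)) \<longlongrightarrow> 0) at_top"
    unfolding eq by (intro tendsto_null_sum L(2))
  show "((\<lambda>x. P x ** weight \<nu> a d x ** madj (Q x)) \<longlongrightarrow> 0) (at_right 0)"
    unfolding eq by (intro tendsto_null_sum L(3))
qed

section \<open>Adjointness of the two operators\<close>

lemma D_op_act:
  "(Q \<cdot>\<^sub>r D_op a) x = x *\<^sub>R (Q x ** (A_mat a - mat 1)) + x *\<^sub>R vector_derivative Q (at x)"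
  by (simp add: diffop_act_def D_op_def numeral_2_eq_2 mm.scaleR_right)

lemma D_dag_act:
  "(Q \<cdot>\<^sub>r D_dag \<nu>) x =
    - ((1 + \<nu>) *\<^sub>R Q x + Q x ** J_mat) - x *\<^sub>R vector_derivative Q (at x)"
proof -
  have "Q x ** - (mat (of_real (1 + \<nu>)) + J_mat) = - ((1 + \<nu>) *\<^sub>R Q x + Q x ** J_mat)"
    by (simp only: mm.minus_right mm.add_right mat_of_real_mult)
  then show ?thesis
    by (simp add: diffop_act_def D_dag_def numeral_2_eq_2 mm.minus_right del: of_real_add)
qed

lemma matpoly_x_derivative:
  assumes "matpoly Q"
  shows "matpoly (\<lambda>x. x *\<^sub>R vector_derivative Q (at x))"
    and "(Q has_vector_derivative vector_derivative Q (at x)) (at x)"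
  using assms deg_lt_derivative deg_lt_imp_matpoly
  unfolding matpoly_iff_deg_lt vector_derivative_works[symmetric] by blast+

lemma matpoly_D_op:
  assumes "matpoly Q" shows "matpoly (Q \<cdot>\<^sub>r D_op a)"
proof -
  have "matpoly (\<lambda>x. x ^ 1 *\<^sub>R (Q x ** (A_mat a - mat 1)) + x *\<^sub>R vector_derivative Q (at x))"
    by (intro matpoly_add matpoly_pow_scaleR matpoly_mult matpoly_const matpoly_x_derivative assms)
  moreover have "(Q \<cdot>\<^sub>r D_op a) = (\<lambda>x. x ^ 1 *\<^sub>R (Q x ** (A_mat a - mat 1)) + x *\<^sub>R vector_derivative Q (at x))"
    by (rule ext) (simp add: D_op_act)
  ultimately show ?thesis by simp
qed

lemma matpoly_D_dag:
  assumes "matpoly Q" shows "matpoly (Q \<cdot>\<^sub>r D_dag \<nu>)"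
proof -
  have "matpoly (\<lambda>x. Q x ** (- ((1 + \<nu>) *\<^sub>R mat 1) - J_mat) + (x *\<^sub>R vector_derivative Q (at x)) ** (- mat 1))"
    by (intro matpoly_add matpoly_mult matpoly_const matpoly_x_derivative assms)
  moreover have "(Q \<cdot>\<^sub>r D_dag \<nu>) =
      (\<lambda>x. Q x ** (- ((1 + \<nu>) *\<^sub>R mat 1) - J_mat) + (x *\<^sub>R vector_derivative Q (at x)) ** (- mat 1))"
    by (rule ext) (simp add: D_dag_act mm.minus_right mm.diff_right mm.scaleR_right)
  ultimately show ?thesis by simp
qed

text \<open>
  Integration by parts: the difference of the two integrands is the derivative of $x\,Q W R^*$ by
  \<open>weight_vector_derivative\<close>, and this function vanishes at both ends of the half-line.
\<close>
lemma weight_adjoint: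
  fixes Q R :: "real \<Rightarrow> 'n::{finite,linorder} cmat"
  assumes \<nu>: "\<nu> > 0" and Q: "matpoly Q" and R: "matpoly R"
  shows "inner_prod (weight \<nu> a d) (Q \<cdot>\<^sub>r D_op a) R = inner_prod (weight \<nu> a d) Q (R \<cdot>\<^sub>r D_dag \<nu>)"
proof -
  let ?W = "weight \<nu> a d :: real \<Rightarrow> 'n cmat"
  define f where "f x = (Q \<cdot>\<^sub>r D_op a) x ** ?W x ** madj (R x) - Q x ** ?W x ** madj ((R \<cdot>\<^sub>r D_dag \<nu>) x)" for x
  \<comment> \<open>The factor \<open>x\<close> is absorbed into the polynomial, so that the limits of polynomial integrands apply.\<close>
  define F where "F x = (x ^ 1 *\<^sub>R Q x) ** ?W x ** madj (R x)" for x
  have xQ: "matpoly (\<lambda>x. x ^ 1 *\<^sub>R Q x)" by (rule matpoly_pow_scaleR[OF Q])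
  have int: "set_integrable lborel {0..} (\<lambda>x. (Q \<cdot>\<^sub>r D_op a) x ** ?W x ** madj (R x))"
    "set_integrable lborel {0..} (\<lambda>x. Q x ** ?W x ** madj ((R \<cdot>\<^sub>r D_dag \<nu>) x))"
    by (intro weight_integrand_regularity(1) \<nu> Q R matpoly_D_op matpoly_D_dag)+
  have f_int: "set_integrable lborel {0..} f"
    unfolding f_def by (rule set_integral_diff(1)[OF int])
  have F': "(F has_vector_derivative f x) (at x)" if x: "x > 0" for x
  proof -
    let ?Q' = "vector_derivative Q (at x)" and ?R' = "vector_derivative R (at x)"
    obtain W' where W': "(?W has_vector_derivative W') (at x)"
      "x *\<^sub>R W' = x *\<^sub>R ((A_mat a - mat 1) ** ?W x) + \<nu> *\<^sub>R ?W x + ?W x ** J_mat"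
      by (rule weight_vector_derivative[OF x])
    have R': "((\<lambda>x. madj (R x)) has_vector_derivative madj ?R') (at x)"
      by (rule bounded_linear.has_vector_derivative[OF bounded_linear_madj matpoly_x_derivative(2)[OF R]])
    have xQ': "((\<lambda>x. x ^ 1 *\<^sub>R Q x) has_vector_derivative (x *\<^sub>R ?Q' + Q x)) (at x)"
      using has_vector_derivative_scaleR[OF DERIV_ident matpoly_x_derivative(2)[OF Q], of x] by simp
    have "(F has_vector_derivative ((x ^ 1 *\<^sub>R Q x) ** ?W x) ** madj ?R'
       + ((x ^ 1 *\<^sub>R Q x) ** W' + (x *\<^sub>R ?Q' + Q x) ** ?W x) ** madj (R x)) (at x)"
      unfolding F_def by (intro mm.has_vector_derivative xQ' W'(1) R')
    also have "((x ^ 1 *\<^sub>R Q x) ** ?W x) ** madj ?R'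
       + ((x ^ 1 *\<^sub>R Q x) ** W' + (x *\<^sub>R ?Q' + Q x) ** ?W x) ** madj (R x) =
       Q x ** ?W x ** (x *\<^sub>R madj ?R') + (Q x ** (x *\<^sub>R W') + (x *\<^sub>R ?Q' + Q x) ** ?W x) ** madj (R x)"
      by (simp add: mm.scaleR_left mm.scaleR_right)
    \<comment> \<open>After the weight equation both sides have the same terms.\<close>
    also have "\<dots> = f x"
      unfolding W'(2)
      by (simp add: f_def D_op_act D_dag_act madj_add madj_diff madj_minus madj_scaleR madj_mult madj_J_mat
          mm.add_left mm.add_right mm.diff_left mm.diff_right mm.minus_left mm.minus_right
          mm.scaleR_left mm.scaleR_right matrix_mul_assoc scaleR_add_left scaleR_add_right scaleR_diff_right)
    finally show ?thesis .
  qed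
  have cont_poly: "isCont G x" if "matpoly G" for G :: "real \<Rightarrow> 'n cmat" and x
    using matpoly_x_derivative(2)[OF that] has_vector_derivative_continuous by blast
  have f_cont: "isCont f x" if x: "x > 0" for x
  proof -
    obtain W' where "(?W has_vector_derivative W') (at x)"
      by (rule weight_vector_derivative[OF x])
    then have "isCont ?W x" by (rule has_vector_derivative_continuous)
    then show ?thesis
      unfolding f_def
      by (intro continuous_diff mm.continuous cont_poly[OF Q] cont_poly[OF matpoly_D_op[OF Q]]
          cont_poly[OF matpoly_madj[OF R]] cont_poly[OF matpoly_madj[OF matpoly_D_dag[OF R]]])
  qed
  have "(LBINT x=ereal 0..\<infinity>. f x) = 0 - 0"
  proof (rule interval_integral_FTC_integrable[where F = F])
    show "set_integrable lborel (einterval (ereal 0) \<infinity>) f"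
      by (rule set_integrable_subset[OF f_int]) (auto simp: einterval_def)
    show "((F \<circ> real_of_ereal) \<longlongrightarrow> 0) (at_right (ereal 0))" "((F \<circ> real_of_ereal) \<longlongrightarrow> 0) (at_left \<infinity>)"
      using weight_integrand_regularity(2,3)[OF \<nu> xQ R, of a d] unfolding ereal_tendsto_simps F_def by auto
  qed (use F' f_cont in auto)
  then have "(LINT x:{0<..}|lborel. f x) = 0"
    by (simp add: interval_integral_to_infinity_eq)
  \<comment> \<open>The endpoint contributes nothing, since the weight vanishes there.\<close>
  moreover have "indicator {0<..} x *\<^sub>R f x = indicator {0..} x *\<^sub>R f x" for x
    by (cases "x = 0") (auto simp: f_def indicator_def)
  ultimately have "(LINT x:{0..}|lborel. f x) = 0"
    by (simp add: set_lebesgue_integral_def)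
  then show ?thesis
    using set_integral_diff(2)[OF int] by (simp add: f_def inner_prod_def)
qed

text \<open>
  With $G = P E$, the $i$-th diagonal entry of $P W P^* = G T G^*$ is a sum of the squares $|G_{ik}|^2$
  with weights $T_{kk} > 0$ on the open half-line. A vanishing integral therefore makes $G$ zero almost
  everywhere there, so the polynomial $G$ has infinitely many zeros and vanishes identically; and $E$ is
  invertible.
\<close>
lemma weight_definite:
  fixes P :: "real \<Rightarrow> 'n::{finite,linorder} cmat"
  assumes \<nu>: "\<nu> > 0" and d: "\<And>k. k \<in> {1..CARD('n)} \<Longrightarrow> d k > 0"
    and P: "matpoly P" and zero: "inner_prod (weight \<nu> a d) P P = 0"
  shows "P x = 0"
proof -
  define G where "G x = P x ** mexp (x *\<^sub>R A_mat a)" for x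
  define t where "t x k = exp (- x) * (d (pos k) * x powr (\<nu> + real (pos k)))" for x and k :: 'n
  define g where "g i x = (\<Sum>k\<in>UNIV. t x k * (cmod (G x $ i $ k))\<^sup>2)" for i x
  have d': "d (pos k) > 0" for k :: 'n using d pos_bounds[of k] by simp
  have t_pos: "t x k \<ge> 0" "x > 0 \<Longrightarrow> t x k > 0" for x k
    using d'[of k] by (auto simp: t_def)
  have g_eq: "(P x ** weight \<nu> a d x ** madj (P x)) $ i $ i = complex_of_real (g i x)" for i x
  proof -
    have "P x ** weight \<nu> a d x ** madj (P x) = G x ** T_weight \<nu> d x ** madj (G x)"
      by (simp add: G_def weight_eq madj_mult matrix_mul_assoc)
    moreover have "(G x ** T_weight \<nu> d x) $ i $ k = G x $ i $ k * of_real (t x k)" for k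
      by (simp add: matrix_matrix_mult_def T_weight_nth t_def if_distrib[of "\<lambda>x. _ * x"] cong: if_cong)
    moreover have "(X ** madj Y) $ i $ i = (\<Sum>k\<in>UNIV. X $ i $ k * cnj (Y $ i $ k))" for X Y :: "'n cmat"
      by (simp add: matrix_matrix_mult_def madj_def)
    ultimately show ?thesis
      by (simp add: g_def complex_norm_square mult_ac del: of_real_power)
  qed
  define T :: "'n \<Rightarrow> 'n cmat \<Rightarrow> real" where "T i X = Re (X $ i $ i)" for i X
  have T: "bounded_linear (T i)" for i
    unfolding T_def linear_conv_bounded_linear[symmetric] by (auto intro!: linearI)
  note int = weight_integrand_regularity(1)[OF \<nu> P P, of a d, unfolded set_integrable_def]
  have Tg: "T i (indicator {0..} x *\<^sub>R (P x ** weight \<nu> a d x ** madj (P x))) = indicator {0..} x * g i x" for i x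
    by (simp add: T_def g_eq)
  have "AE x in lborel. indicator {0..} x * g i x = 0" for i
  proof (subst integral_nonneg_eq_0_iff_AE[symmetric])
    show "integrable lborel (\<lambda>x. indicator {0..} x * g i x)"
      using integrable_bounded_linear[OF T int, of i] by (simp add: Tg)
    show "AE x in lborel. 0 \<le> indicator {0..} x * g i x"
      by (auto simp: g_def t_pos intro!: sum_nonneg mult_nonneg_nonneg)
    show "(LBINT x. indicator {0..} x * g i x) = 0"
      using integral_bounded_linear[OF T int, of i] zero
      by (simp add: Tg inner_prod_def set_lebesgue_integral_def) (simp add: T_def)
  qed
  then have "AE x in lborel. \<forall>i\<in>UNIV. indicator {0..} x * g i x = 0"
    by (subst AE_finite_all) auto
  then have AE: "AE x in lborel. x > 0 \<longrightarrow> G x = 0"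
  proof eventually_elim
    case (elim x)
    show ?case
    proof
      assume "x > 0"
      then have "g i x = 0" for i using elim by simp
      then have "t x k * (cmod (G x $ i $ k))\<^sup>2 = 0" for i k
        unfolding g_def by (subst (asm) sum_nonneg_eq_0_iff) (auto simp: t_pos)
      then show "G x = 0" using t_pos(2)[OF \<open>x > 0\<close>] by (simp add: vec_eq_iff less_le)
    qed
  qed
  have inf: "infinite {x. G x = 0}"
  proof
    assume "finite {x. G x = 0}"
    then have "AE x in lborel. x \<notin> {x. G x = 0}"
      by (intro AE_not_in finite_imp_null_set_lborel)
    with AE have "AE x in lborel. x \<notin> {0<..<1::real}" by eventually_elim auto
    then have "{0<..<1::real} \<in> null_sets lborel" by (subst AE_iff_null_sets) auto
    then show False by (simp add: null_sets_def)
  qed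
  have "matpoly G" unfolding G_def by (intro matpoly_mult P matpoly_mexp_nilpotent[OF mpow_A_eq_0])
  then obtain n c where c: "\<And>x. G x = (\<Sum>i\<le>n. x ^ i *\<^sub>R c i)"
    unfolding matpoly_def by blast
  have "G x = 0"
    unfolding c using matpoly_coefficients_eq_0[OF inf[unfolded c]] by simp
  moreover have "mexp (x *\<^sub>R A_mat a) ** mexp (- x *\<^sub>R A_mat a) = (mat 1 :: 'n cmat)"
    by (rule mexp_minus_inverse[OF mpow_A_eq_0])
  then have "P x = G x ** mexp (- x *\<^sub>R A_mat a)"
    by (simp add: G_def matrix_mul_assoc[symmetric])
  ultimately show ?thesis by simp
qed

section \<open>Leading coefficients and the recurrences\<close>

text \<open>
  The term $x\,\partial_x P$ has degree at most $n$, so the top coefficient comes from $x P (A-1)$ only;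
  a monic $P'$ of degree $n+1$ (not the derivative of $P$) serves to cancel it.
\<close>
lemma D_op_leading:
  fixes P P' :: "real \<Rightarrow> 'n::{finite,linorder} cmat"
  assumes "deg_lt n (\<lambda>x. P x - x ^ n *\<^sub>R mat 1)" "deg_lt (Suc n) (\<lambda>x. P' x - x ^ Suc n *\<^sub>R mat 1)"
  shows "deg_lt (Suc n) (\<lambda>x. (P \<cdot>\<^sub>r D_op a) x - (A_mat a - mat 1) ** P' x)"
proof -
  let ?B = "A_mat a - mat 1 :: 'n cmat"
  have "deg_lt (Suc n) (\<lambda>x. (P x - x ^ n *\<^sub>R mat 1) + x ^ n *\<^sub>R mat 1)"
    by (intro deg_lt_add deg_lt_mono[OF assms(1)] deg_lt_monom) simp_all
  then have P: "deg_lt (Suc n) P" by simp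
  have "deg_lt (Suc n) (\<lambda>x. x *\<^sub>R ((P x - x ^ n *\<^sub>R mat 1) ** ?B) + x *\<^sub>R vector_derivative P (at x)
      - ?B ** (P' x - x ^ Suc n *\<^sub>R mat 1))"
    by (intro deg_lt_add deg_lt_diff deg_lt_times_x deg_lt_mult_right deg_lt_mult_left deg_lt_derivative P assms)
  then show ?thesis
    by (simp add: D_op_act mm.diff_left mm.diff_right mm.scaleR_left mm.scaleR_right algebra_simps)
qed

text \<open>
  Both $J$ and $x\,\partial_x$ act on the leading term $x^n$: the latter contributes the eigenvalue $n$.
  The constant stands to the left of $P$ and $J$ acts from the right, but on the leading term, a
  multiple of the identity, the two sides agree.
\<close>
lemma D_dag_leading:
  fixes P :: "real \<Rightarrow> 'n::{finite,linorder} cmat"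
  assumes "deg_lt n (\<lambda>x. P x - x ^ n *\<^sub>R mat 1)"
  shows "deg_lt n (\<lambda>x. (P \<cdot>\<^sub>r D_dag \<nu>) x - (- (mat (of_real (real n + \<nu> + 1)) + J_mat)) ** P x)"
proof -
  let ?r = "\<lambda>x. P x - x ^ n *\<^sub>R mat 1"
  have "vector_derivative P (at x) = vector_derivative ?r (at x) + (real n * x ^ (n - 1)) *\<^sub>R mat 1" for x
  proof (rule vector_derivative_at)
    have "((\<lambda>x. x ^ n *\<^sub>R mat 1 :: 'n cmat) has_vector_derivative (real n * x ^ (n - 1)) *\<^sub>R mat 1) (at x)"
      by (auto intro!: derivative_eq_intros)
    from has_vector_derivative_add[OF deg_lt_derivative(2)[OF assms, unfolded vector_derivative_works] this]
    show "(P has_vector_derivative vector_derivative ?r (at x) + (real n * x ^ (n - 1)) *\<^sub>R mat 1) (at x)"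
      by simp
  qed
  then have xP': "x *\<^sub>R vector_derivative P (at x) = x *\<^sub>R vector_derivative ?r (at x) + (real n * x ^ n) *\<^sub>R mat 1" for x
    by (cases n) (simp_all add: scaleR_add_right mult.left_commute)
  \<comment> \<open>The leading terms cancel, and these combinations of the lower part \<open>r\<close> remain.\<close>
  have "deg_lt n (\<lambda>x. real n *\<^sub>R ?r x + (J_mat ** ?r x - ?r x ** J_mat) - x *\<^sub>R vector_derivative ?r (at x))"
    by (intro deg_lt_add deg_lt_diff deg_lt_mult_right deg_lt_mult_left deg_lt_derivative
        deg_lt_linear[OF linear_scaleR] assms)
  also have "(\<lambda>x. real n *\<^sub>R ?r x + (J_mat ** ?r x - ?r x ** J_mat) - x *\<^sub>R vector_derivative ?r (at x)) =
      (\<lambda>x. (P \<cdot>\<^sub>r D_dag \<nu>) x - (- (mat (of_real (real n + \<nu> + 1)) + J_mat)) ** P x)"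
    by (rule ext) (simp only: D_dag_act xP' mat_of_real_mult mm.add_left mm.minus_left,
        simp add: mm.diff_left mm.diff_right mm.scaleR_left mm.scaleR_right algebra_simps)
  finally show ?thesis .
qed

lemma ext0_shift:
  "ext0 P (int n + 1) = P (Suc n)" "ext0 P (int n) = P n"
  "ext0 P (int n - 1) = (if n = 0 then (\<lambda>x. 0) else P (n - 1))"
  by (auto simp: ext0_def nat_diff_distrib nat_add_distrib)

theorem proposition5p1:
  fixes \<nu> :: real
    and a d :: "nat \<Rightarrow> real"
    and P :: "nat \<Rightarrow> real \<Rightarrow> 'n::{finite,linorder} cmat"
    and H :: "nat \<Rightarrow> 'n cmat"
  assumes "\<nu> > 0"
    and "\<And>k. k \<in> {1..CARD('n)} \<Longrightarrow> d k > 0"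
    and "monic_mvop (weight \<nu> a d) P H"
  shows "(\<forall>Q R :: real \<Rightarrow> 'n cmat. matpoly Q \<longrightarrow> matpoly R \<longrightarrow>
            inner_prod (weight \<nu> a d) (Q \<cdot>\<^sub>r D_op a) R = inner_prod (weight \<nu> a d) Q (R \<cdot>\<^sub>r D_dag \<nu>))
       \<and> (\<forall>n. P n \<cdot>\<^sub>r D_op a = (M_op \<nu> a H \<cdot>\<^sub>l P) n)
       \<and> (\<forall>n. P n \<cdot>\<^sub>r D_dag \<nu> = (M_dag \<nu> a H \<cdot>\<^sub>l P) n)"
proof -
  interpret mvop "weight \<nu> a d :: real \<Rightarrow> 'n cmat" P H
    by standard (use weight_integrand_regularity(1) madj_weight weight_definite assms in blast)+
  let ?B = "\<lambda>n :: nat. A_mat a - mat 1 :: 'n cmat"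
  let ?K = "\<lambda>n. - (mat (of_real (real n + \<nu> + 1)) + J_mat) :: 'n cmat"
  have D: "(P n \<cdot>\<^sub>r D_op a) x = (A_mat a - mat 1) ** P (Suc n) x
      + (H n ** madj (?K n) ** matrix_inv (H n)) ** P n x" for n x
    by (rule raising_recurrence[where L = "\<lambda>Q. Q \<cdot>\<^sub>r D_op a" and L' = "\<lambda>Q. Q \<cdot>\<^sub>r D_dag \<nu>" and B = ?B and K = ?K])
       (rule D_op_leading D_dag_leading deg_lt_P_minus_monom weight_adjoint[OF assms(1)] | assumption)+
  have D': "(P n \<cdot>\<^sub>r D_dag \<nu>) x = ?K n ** P n x +
     (if n = 0 then 0 else (H n ** madj (A_mat a - mat 1) ** matrix_inv (H (n - 1))) ** P (n - 1) x)" for n x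
    by (rule preserving_recurrence[where L = "\<lambda>Q. Q \<cdot>\<^sub>r D_op a" and L' = "\<lambda>Q. Q \<cdot>\<^sub>r D_dag \<nu>" and B = ?B and K = ?K])
       (rule D_op_leading D_dag_leading deg_lt_P_minus_monom weight_adjoint[OF assms(1)] | assumption)+
  \<comment> \<open>The scalar part of \<open>K\<close> passes through the conjugation by \<open>H n\<close>, and \<open>J\<close> is self-adjoint.\<close>
  have K: "H n ** madj (?K n) ** matrix_inv (H n) =
      - mat (of_real (real n + 1 + \<nu>)) - H n ** J_mat ** matrix_inv (H n)" for n
  proof -
    have "H n ** madj (?K n) ** matrix_inv (H n) =
        - ((real n + \<nu> + 1) *\<^sub>R (H n ** matrix_inv (H n))) - H n ** J_mat ** matrix_inv (H n)"
      by (simp only: madj_minus madj_add madj_mat madj_J_mat complex_cnj_complex_of_real mm.minus_right mm.add_right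
          mm.minus_left mm.add_left mat_of_real_mult mm.scaleR_left minus_add_distrib diff_conv_add_uminus)
    also have "(real n + \<nu> + 1) *\<^sub>R (H n ** matrix_inv (H n)) = mat (of_real (real n + 1 + \<nu>))"
      using mat_of_real_mult(1)[of "real n + 1 + \<nu>" "mat 1 :: 'n cmat"]
      by (simp only: H_matrix_inv matrix_mul_rid ac_simps)
    finally show ?thesis .
  qed
  have "P n \<cdot>\<^sub>r D_op a = (M_op \<nu> a H \<cdot>\<^sub>l P) n" for n
    by (rule ext) (simp add: D[unfolded K] shiftop_act_def M_op_def ext0_shift del: of_real_add)
  moreover have "P n \<cdot>\<^sub>r D_dag \<nu> = (M_dag \<nu> a H \<cdot>\<^sub>l P) n" for n
    by (rule ext) (simp add: D' shiftop_act_def M_dag_def ext0_shift del: of_real_add)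
  ultimately show ?thesis using weight_adjoint[OF assms(1)] by blast
qed

end
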